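(* Let $m\ge5$ be odd, $h=\frac{m-1}{2}$, $f_4(x)=x+x^3+x^{2^m-2^{h+2}+2}\in\mathbb{F}_{2^m}[x]$, and let $s^\infty$ be the sequence $s_t=\operatorname{Tr}(f_4(\alpha^t+1))$, $t\ge0$. Then the binary cyclic code $\mathcal{C}_s$ has parameters $[2^m-1,\,2^m-1-L_s,\,d(\mathcal{C}_s)]$, where $L_s=1+m(2^{(m-3)/2}+1)$ if $m\equiv1\pmod4$ and $L_s=1+m(2^{(m-3)/2}-1)$ if $m\equiv3\pmod4$, and $$\max\{8,\,2^{(m-5)/2}+2\}\le d(\mathcal{C}_s)\le 1+m(2^{(m-3)/2}+1)\quad\text{if } m\equiv 1\pmod 4,$$ $$2^{(m-5)/2}+2\le d(\mathcal{C}_s)\le 1+m(2^{(m-3)/2}-1)\quad\text{if } m\equiv 3\pmod 4.$$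
   Context: Let $v=2^m-1$, $\alpha$ a primitive element of $\mathbb{F}_{2^m}$, and $\operatorname{Tr}(x)=\sum_{i=0}^{m-1}x^{2^i}$ the absolute trace from $\mathbb{F}_{2^m}$ to $\mathbb{F}_2$. For a polynomial $F$ over $\mathbb{F}_{2^m}$ the binary sequence $s^\infty=(s_t)_{t\ge0}$ is defined by $s_t=\operatorname{Tr}(F(\alpha^t+1))$; it is periodic with period dividing $v$. Its minimal polynomial $g_s(x)$ is the polynomial $1+c_1x+\dots+c_Lx^L\in\mathbb{F}_2[x]$ of least degree $L$ such that $s_i+c_1s_{i-1}+\dots+c_Ls_{i-L}=0$ for all $i\ge L$; its degree $L_s$ is the linear span of $s^\infty$. $\mathcal{C}_s$ denotes the binary cyclic code of length $v$ with generator polynomial $g_s(x)$. $d(\mathcal{C})$ denotes minimum Hamming distance. *)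

theory Defs
  imports "HOL-Computational_Algebra.Polynomial"
begin

text \<open>Absolute trace from F_{2^m} to F_2 (F_2 = {0,1} inside the field).\<close>
definition trace2 :: "nat \<Rightarrow> 'a::field \<Rightarrow> 'a" where
  "trace2 m x = (\<Sum>i<m. x ^ (2 ^ i))"

definition primitive_elem :: "'a::field \<Rightarrow> bool" where
  "primitive_elem \<alpha> \<longleftrightarrow> \<alpha> \<noteq> 0 \<and> (\<forall>x. x \<noteq> 0 \<longrightarrow> (\<exists>k::nat. x = \<alpha> ^ k))"

definition binary_poly :: "'a::field poly \<Rightarrow> bool" where
  "binary_poly g \<longleftrightarrow> (\<forall>i. coeff g i \<in> {0, 1})"

definition conn_poly :: "(nat \<Rightarrow> 'a::field) \<Rightarrow> 'a poly \<Rightarrow> bool" where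
  "conn_poly s g \<longleftrightarrow> binary_poly g \<and> coeff g 0 = 1 \<and>
     (\<forall>i\<ge>degree g. (\<Sum>j\<le>degree g. coeff g j * s (i - j)) = 0)"

definition linear_span :: "(nat \<Rightarrow> 'a::field) \<Rightarrow> nat" where
  "linear_span s = (LEAST L. \<exists>g. conn_poly s g \<and> degree g = L)"

definition minimal_poly_seq :: "(nat \<Rightarrow> 'a::field) \<Rightarrow> 'a poly \<Rightarrow> bool" where
  "minimal_poly_seq s g \<longleftrightarrow> conn_poly s g \<and> degree g = linear_span s"

definition cyclic_code :: "nat \<Rightarrow> 'a::field poly \<Rightarrow> 'a poly set" where
  "cyclic_code v g = {c. binary_poly c \<and> (c = 0 \<or> degree c < v) \<and> g dvd c}"

definition hamming_dist :: "'a::zero poly \<Rightarrow> 'a poly \<Rightarrow> nat" where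
  "hamming_dist c c' = card {i. coeff c i \<noteq> coeff c' i}"

definition min_dist :: "'a::zero poly set \<Rightarrow> nat" where
  "min_dist C = Min {hamming_dist c c' | c c'. c \<in> C \<and> c' \<in> C \<and> c \<noteq> c'}"

end

theory Submission
  imports Defs "HOL-Number_Theory.Cong"
begin

text \<open>
  Put \<open>k = (m - 3) / 2\<close> and \<open>y = x + 1\<close>. Under the trace the exponent \<open>2^m - 2^(k+3) + 2\<close> may be
  replaced by \<open>2^(k+1) + 2^k - 1\<close>, and \<open>(x + 1)^(2^k - 1)\<close> is \<open>1 + x + \<dots> + x^(2^k - 1)\<close> in
  characteristic 2. Since \<open>Tr(z\<^sup>2) = Tr(z)\<close>, the sequence becomes \<open>s\<^sub>t = 1 + \<Sum>\<^sub>n Tr(\<alpha>^(nt))\<close>, where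
  \<open>n\<close> runs through the odd numbers below \<open>2^(k+2)\<close> that survive cancellation modulo 2. These lie in
  distinct cyclotomic cosets of size \<open>m\<close>, so \<open>s\<^sub>t\<close> is a sum of \<open>t\<close>-th powers of distinct field
  elements, and a Vandermonde argument shows that the minimal polynomial has exactly their
  inverses as roots.

  All odd \<open>n\<close> between \<open>2^(k+1)\<close> and \<open>2^(k+1) + 2^k\<close> survive; this is an arithmetic progression of
  \<open>2^(k-1)\<close> zeros, and the BCH bound gives \<open>2^(k-1) + 1\<close>. As 1 is a zero, all weights are even, which
  improves this bound by one and also pushes the Singleton bound down to \<open>L\<^sub>s\<close>. The bound 8 needs
  separate work only for \<open>m = 5\<close> (BCH) and \<open>m = 9\<close> (Hartmann--Tzeng).
\<close>

subsection \<open>A Vandermonde argument in two directions\<close>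

text \<open>The vanishing sums say that \<open>y\<close> annihilates every product p(X) q(Z) with
  deg p < \<open>l\<close> and deg q \<le> \<open>r\<close>. One such product vanishes on
  \<open>T\<close> except at \<open>u\<close>: p kills up to \<open>l - 1\<close> of the other
  points and q the at most \<open>r\<close> left over.\<close>

lemma two_sided_vandermonde:
  fixes X Z y :: "'b \<Rightarrow> 'a::field"
  assumes fin: "finite T" and injX: "inj_on X T" and injZ: "inj_on Z T"
    and l: "l > 0" and card_le: "card T \<le> l + r"
    and zero: "\<And>i j. i < l \<Longrightarrow> j \<le> r \<Longrightarrow> (\<Sum>t\<in>T. y t * X t ^ i * Z t ^ j) = 0"
    and u: "u \<in> T"
  shows "y u = 0"
proof -
  have combine: "(\<Sum>t\<in>T. y t * poly p (X t) * poly q (Z t)) = 0"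
    if p: "degree p < l" and q: "degree q \<le> r" for p q
  proof -
    have "(\<Sum>t\<in>T. y t * poly p (X t) * poly q (Z t))
        = (\<Sum>t\<in>T. \<Sum>i\<le>degree p. \<Sum>j\<le>degree q. coeff p i * coeff q j * (y t * X t ^ i * Z t ^ j))"
      by (simp add: poly_altdef sum_distrib_left sum_distrib_right mult_ac)
    also have "\<dots> = (\<Sum>i\<le>degree p. \<Sum>j\<le>degree q. coeff p i * coeff q j * (\<Sum>t\<in>T. y t * X t ^ i * Z t ^ j))"
      by (subst sum.swap, rule sum.cong[OF refl], subst sum.swap) (simp add: sum_distrib_left)
    also have "\<dots> = 0"
      using p q by (intro sum.neutral ballI) (simp add: zero)
    finally show ?thesis .
  qed
  have "card (T - {u}) \<le> (l - 1) + r"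
    using card_le fin u l by simp
  moreover obtain U where U: "U \<subseteq> T - {u}" "card U = min (l - 1) (card (T - {u}))"
    by (meson min.cobounded2 obtain_subset_with_card_n)
  ultimately have W: "card (T - {u} - U) \<le> r"
    using fin by (subst card_Diff_subset) (auto intro: finite_subset)
  define W where "W = T - {u} - U"
  have finU: "finite U" and finW: "finite W"
    using fin U by (auto simp: W_def intro: finite_subset)
  define p where "p = (\<Prod>w\<in>U. [:- X w, 1:])"
  define q where "q = (\<Prod>w\<in>W. [:- Z w, 1:])"
  have "degree p = card U"
    unfolding p_def by (subst degree_prod_sum_eq) auto
  then have dp: "degree p < l"
    using U l by simp
  have "degree q = card W"
    unfolding q_def by (subst degree_prod_sum_eq) auto
  then have dq: "degree q \<le> r"
    using W by (simp add: W_def)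
  have "y t * poly p (X t) * poly q (Z t) = 0" if "t \<in> T - {u}" for t
    using that finU finW by (cases "t \<in> U") (auto simp: p_def q_def poly_prod W_def)
  then have "y u * poly p (X u) * poly q (Z u) = 0"
    using combine[OF dp dq] fin u by (subst (asm) sum.remove[of T u]) (auto simp: sum.neutral)
  moreover have "poly p (X u) \<noteq> 0"
    using U u injX finU by (auto simp: p_def poly_prod inj_on_def)
  moreover have "poly q (Z u) \<noteq> 0"
    using u injZ finW by (auto simp: q_def poly_prod inj_on_def W_def)
  ultimately show ?thesis
    by simp
qed

section \<open>Weights and the Hartmann-Tzeng bound\<close>

abbreviation weight :: "'a::zero poly \<Rightarrow> nat" where
  "weight c \<equiv> card {i. coeff c i \<noteq> 0}"

lemma finite_support: "finite {i. coeff c i \<noteq> 0}"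
  by (rule finite_subset[of _ "{..degree c}"]) (auto intro: le_degree)

lemma poly_sum_support: "poly (c :: 'a::comm_semiring_1 poly) x =
   (\<Sum>i | coeff c i \<noteq> 0. coeff c i * x ^ i)"
  unfolding poly_altdef
  by (rule sum.mono_neutral_right) (auto intro: le_degree)

text \<open>A support of size at most \<open>l + r\<close> is small enough for the two-sided
  argument, with points b^t and d^t, to make all coefficients vanish. For \<open>r = 0\<close> this
  is the BCH bound.\<close>

lemma hartmann_tzeng_bound:
  fixes c :: "'a::field poly"
  assumes c: "c \<noteq> 0" "degree c < v" and a: "a \<noteq> 0"
    and b: "inj_on (\<lambda>t. b ^ t) {..<v}" and d: "inj_on (\<lambda>t. d ^ t) {..<v}"
    and l: "l > 0"
    and roots: "\<And>i j. i < l \<Longrightarrow> j \<le> r \<Longrightarrow> poly c (a * b ^ i * d ^ j) = 0"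
  shows "l + r + 1 \<le> weight c"
proof (rule ccontr)
  let ?T = "{i. coeff c i \<noteq> 0}"
  assume "\<not> ?thesis"
  then have small: "card ?T \<le> l + r"
    by simp
  have T: "?T \<subseteq> {..<v}"
    using c(2) le_degree by fastforce
  have "coeff c t * a ^ t = 0" if "t \<in> ?T" for t
  proof (rule two_sided_vandermonde[OF finite_support _ _ l small _ that,
        where X = "\<lambda>t. b ^ t" and Z = "\<lambda>t. d ^ t" and y = "\<lambda>t. coeff c t * a ^ t"])
    show "inj_on (\<lambda>t. b ^ t) ?T" "inj_on (\<lambda>t. d ^ t) ?T"
      using b d T by (blast intro: inj_on_subset)+
    fix i j assume "i < l" "j \<le> r"
    from roots[OF this] show "(\<Sum>t\<in>?T. coeff c t * a ^ t * (b ^ t) ^ i * (d ^ t) ^ j) = 0"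
      by (simp add: poly_sum_support power_mult_distrib mult.assoc flip: power_mult)
        (simp add: mult_ac)
  qed
  then have "coeff c t = 0" for t
    using a by auto
  then show False
    using c(1) by (simp add: poly_eq_iff)
qed

subsection \<open>Binary polynomials and their cyclic codes\<close>

lemma add_self_char2: "CHAR('a::comm_ring_1) = 2 \<Longrightarrow> x + x = (0::'a)"
  by (metis mult_2 mult_zero_left of_nat_CHAR of_nat_numeral)

lemma minus_char2: "CHAR('a::comm_ring_1) = 2 \<Longrightarrow> - x = (x::'a)"
  by (metis add_self_char2 neg_eq_iff_add_eq_0)

lemma power_two_power_add:
  assumes "CHAR('a::comm_ring_1) = 2"
  shows "(x + y :: 'a) ^ 2 ^ n = x ^ 2 ^ n + y ^ 2 ^ n"
  by (rule freshmans_dream') (simp_all add: assms)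

lemma power2_add_char2:
  assumes "CHAR('a::comm_ring_1) = 2"
  shows "(x + y :: 'a)\<^sup>2 = x\<^sup>2 + y\<^sup>2"
  using power_two_power_add[OF assms, of x y 1] by simp

lemma power2_inject_char2:
  assumes "CHAR('a::idom) = 2" and "x ^ 2 = (y::'a) ^ 2"
  shows "x = y"
  using assms(2) minus_char2[OF assms(1), of y] by (simp add: power2_eq_iff)

lemma coeff_power2_char2:
  fixes p :: "'a::field poly"
  assumes "CHAR('a) = 2"
  shows "coeff (p\<^sup>2) n = (if even n then (coeff p (n div 2))\<^sup>2 else 0)"
proof (induction p arbitrary: n)
  case (pCons a p)
  have "(pCons a p)\<^sup>2 = ([:a:] + pCons 0 p)\<^sup>2"
    by simp
  also have "\<dots> = [:a:]\<^sup>2 + (pCons 0 p)\<^sup>2"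
    by (rule power2_add_char2) (simp add: assms)
  also have "\<dots> = pCons (a\<^sup>2) (pCons 0 (p\<^sup>2))"
    by (simp add: power2_eq_square)
  finally show ?case
    by (auto simp: coeff_pCons pCons.IH split: nat.split)
qed simp

lemma coeff_pcompose_X2:
  fixes p :: "'a::field poly"
  shows "coeff (pcompose p (monom 1 2)) n = (if even n then coeff p (n div 2) else 0)"
proof (induction p arbitrary: n)
  case (pCons a p)
  show ?case
  proof (cases "n < 2")
    case True
    then have "n = 0 \<or> n = 1"
      by auto
    then show ?thesis
      by (auto simp: pcompose_pCons coeff_pCons coeff_monom_mult)
  next
    case False
    then obtain k where "n = k + 2"
      by (metis add.commute le_Suc_ex not_less)
    then show ?thesis
      using pCons.IH[of k] by (auto simp: pcompose_pCons coeff_pCons coeff_monom_mult split: nat.split)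
  qed
qed simp

text \<open>Lying in {0, 1} means solving a^2 = a, and by Frobenius p^2 carries the squared
  coefficients in the even places. This form is compatible with products and cancellation.\<close>

lemma binary_poly_iff_square:
  fixes p :: "'a::field poly"
  assumes "CHAR('a) = 2"
  shows "binary_poly p \<longleftrightarrow> p\<^sup>2 = pcompose p (monom 1 2)"
proof -
  have "p\<^sup>2 = pcompose p (monom 1 2) \<longleftrightarrow> (\<forall>i. (coeff p i)\<^sup>2 = coeff p i)"
  proof
    assume eq: "p\<^sup>2 = pcompose p (monom 1 2)"
    show "\<forall>i. (coeff p i)\<^sup>2 = coeff p i"
    proof
      fix i
      from eq have "coeff (p\<^sup>2) (2 * i) = coeff (pcompose p (monom 1 2)) (2 * i)"
        by (rule arg_cong)
      then show "(coeff p i)\<^sup>2 = coeff p i"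
        by (simp add: coeff_power2_char2[OF assms] coeff_pcompose_X2)
    qed
  qed (simp add: poly_eq_iff coeff_power2_char2[OF assms] coeff_pcompose_X2)
  then show ?thesis
    by (simp add: binary_poly_def power2_eq_square)
qed

lemma binary_poly_mult_iff:
  fixes g q :: "'a::field poly"
  assumes "CHAR('a) = 2" and "binary_poly g" and "g \<noteq> 0"
  shows "binary_poly (g * q) \<longleftrightarrow> binary_poly q"
proof -
  have "binary_poly (g * q) \<longleftrightarrow> g\<^sup>2 * q\<^sup>2 = g\<^sup>2 * pcompose q (monom 1 2)"
    using assms(2)
    by (simp only: binary_poly_iff_square[OF assms(1)] pcompose_mult power_mult_distrib)
  then show ?thesis
    using assms(3) by (simp add: binary_poly_iff_square[OF assms(1)])
qed

lemma binary_poly_diff: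
  fixes p q :: "'a::field poly"
  assumes "CHAR('a) = 2" and "binary_poly p" and "binary_poly q"
  shows "binary_poly (p - q)"
  unfolding binary_poly_def
proof
  fix i
  have "coeff p i \<in> {0, 1}" "coeff q i \<in> {0, 1}"
    using assms by (auto simp: binary_poly_def)
  then show "coeff (p - q) i \<in> {0, 1}"
    using minus_char2[OF assms(1), of 1] by auto
qed

section \<open>Size, weights and minimum distance of a cyclic code\<close>

lemma card_binary_polys:
  "card {q :: 'a::field poly. binary_poly q \<and> (q = 0 \<or> degree q < k)} = 2 ^ k"
proof -
  let ?B = "{q :: 'a poly. binary_poly q \<and> (q = 0 \<or> degree q < k)}"
  let ?p = "\<lambda>A. \<Sum>i\<in>A. monom (1::'a) i"
  have coeff_p: "coeff (?p A) i = (if i \<in> A then 1 else 0)" if "A \<in> Pow {..<k}" for A i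
    using that by (auto simp: coeff_sum dest: finite_subset)
  have "bij_betw ?p (Pow {..<k}) ?B"
  proof (rule bij_betw_byWitness[where f' = "\<lambda>q. {i. coeff q i \<noteq> 0}"])
    show "\<forall>A\<in>Pow {..<k}. {i. coeff (?p A) i \<noteq> 0} = A"
      using coeff_p by auto
    have supp: "{i. coeff q i \<noteq> 0} \<in> Pow {..<k}" if "q \<in> ?B" for q
      using that le_degree by fastforce
    then show "(\<lambda>q. {i. coeff q i \<noteq> 0}) ` ?B \<subseteq> Pow {..<k}"
      by blast
    show "\<forall>q\<in>?B. ?p {i. coeff q i \<noteq> 0} = q"
    proof
      fix q assume q: "q \<in> ?B"
      show "?p {i. coeff q i \<noteq> 0} = q"
        using q by (intro poly_eqI, subst coeff_p[OF supp[OF q]]) (auto simp: binary_poly_def)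
    qed
    show "?p ` Pow {..<k} \<subseteq> ?B"
    proof
      fix q assume "q \<in> ?p ` Pow {..<k}"
      then obtain A where A: "A \<in> Pow {..<k}" "q = ?p A"
        by blast
      have "degree q < k" if "q \<noteq> 0"
        using coeff_p[OF A(1), of "degree q"] A that
        by (metis PowD leading_coeff_0_iff lessThan_iff subsetD)
      then show "q \<in> ?B"
        using A coeff_p[OF A(1)] by (auto simp: binary_poly_def)
    qed
  qed
  from bij_betw_same_card[OF this] show ?thesis
    by (simp add: card_Pow)
qed

lemma card_cyclic_code:
  fixes g :: "'a::field poly"
  assumes char: "CHAR('a) = 2" and bin: "binary_poly g" and g: "g \<noteq> 0" and deg: "degree g \<le> v"
  shows "card (cyclic_code v g) = 2 ^ (v - degree g)"
proof -
  let ?B = "{q :: 'a poly. binary_poly q \<and> (q = 0 \<or> degree q < v - degree g)}"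
  have "g * q = 0 \<or> degree (g * q) < v \<longleftrightarrow> q = 0 \<or> degree q < v - degree g" for q
    using g deg by (cases "q = 0") (auto simp: degree_mult_eq)
  then have "g * q \<in> cyclic_code v g \<longleftrightarrow> q \<in> ?B" for q
    using binary_poly_mult_iff[OF char bin g] by (simp add: cyclic_code_def)
  moreover have "\<exists>q. c = g * q" if "c \<in> cyclic_code v g" for c
    using that by (auto simp: cyclic_code_def)
  ultimately have "cyclic_code v g = (\<lambda>q. g * q) ` ?B"
    by blast
  moreover have "inj_on (\<lambda>q. g * q) ?B"
    using g by (auto simp: inj_on_def)
  ultimately show ?thesis
    by (simp add: card_image card_binary_polys)
qed

text \<open>The value at 1 is the weight reduced modulo 2.\<close>

lemma even_weight:
  fixes c :: "'a::field poly"
  assumes char: "CHAR('a) = 2" and bin: "binary_poly c" and root: "poly c 1 = 0"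
  shows "even (weight c)"
proof -
  have "poly c 1 = (\<Sum>i | coeff c i \<noteq> 0. 1)"
    unfolding poly_sum_support using bin
    by (intro sum.cong) (auto simp: binary_poly_def)
  then have "of_nat (weight c) = (0::'a)"
    using root by simp
  then show ?thesis
    by (simp add: of_nat_eq_0_iff_char_dvd char)
qed

lemma min_dist_cyclic_code:
  fixes g :: "'a::field poly"
  assumes char: "CHAR('a) = 2" and bin: "binary_poly g" and g: "g \<noteq> 0" and deg: "degree g < v"
  shows "min_dist (cyclic_code v g) \<le> weight g"
    and "(\<And>c. c \<in> cyclic_code v g \<Longrightarrow> c \<noteq> 0 \<Longrightarrow> d \<le> weight c) \<Longrightarrow> d \<le> min_dist (cyclic_code v g)"
proof -
  let ?C = "cyclic_code v g"
  let ?D = "{hamming_dist c c' | c c'. c \<in> ?C \<and> c' \<in> ?C \<and> c \<noteq> c'}"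
  have "finite ?C"
    using card_cyclic_code[OF char bin g, of v] deg by (simp add: card_ge_0_finite)
  moreover have "?D \<subseteq> (\<lambda>(c, c'). hamming_dist c c') ` (?C \<times> ?C)"
    by auto
  ultimately have fin: "finite ?D"
    by (meson finite_SigmaI finite_imageI finite_subset)
  have "g \<in> ?C" "0 \<in> ?C"
    using bin deg by (auto simp: cyclic_code_def binary_poly_def)
  then have mem: "weight g \<in> ?D"
    using g by (intro CollectI exI[of _ g] exI[of _ 0]) (simp add: hamming_dist_def)
  then show "min_dist ?C \<le> weight g"
    unfolding min_dist_def using fin by simp
  assume d: "\<And>c. c \<in> ?C \<Longrightarrow> c \<noteq> 0 \<Longrightarrow> d \<le> weight c"
  have "d \<le> hamming_dist c c'" if "c \<in> ?C" "c' \<in> ?C" "c \<noteq> c'" for c c'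
  proof -
    have "c - c' \<in> ?C"
      using that binary_poly_diff[OF char] deg
      by (auto simp: cyclic_code_def intro: degree_diff_less)
    then show ?thesis
      using d[of "c - c'"] that by (simp add: hamming_dist_def)
  qed
  then show "d \<le> min_dist ?C"
    unfolding min_dist_def using fin mem by (intro Min.boundedI) auto
qed

subsection \<open>Linear span of a power-sum sequence\<close>

text \<open>At index i the recurrence says that the sum of \<beta>^i g(1/\<beta>) over
  \<open>Z\<close> is 0. Taking \<open>card Z\<close> consecutive indices gives a Vandermonde system
  in the distinct \<beta>, so every g(1/\<beta>) vanishes.\<close>

lemma conn_poly_power_sums_iff:
  fixes Z :: "'a::field set"
  assumes fin: "finite Z" and ne: "Z \<noteq> {}" and nz: "0 \<notin> Z"
    and s: "\<And>t. s t = (\<Sum>\<beta>\<in>Z. \<beta> ^ t)"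
  shows "conn_poly s g \<longleftrightarrow>
    binary_poly g \<and> coeff g 0 = 1 \<and> (\<forall>\<beta>\<in>Z. poly g (inverse \<beta>) = 0)"
proof -
  have recurrence: "(\<Sum>j\<le>degree g. coeff g j * s (i - j)) = (\<Sum>\<beta>\<in>Z. \<beta> ^ i * poly g (inverse \<beta>))"
    if "i \<ge> degree g" for i
  proof -
    have "(\<Sum>j\<le>degree g. coeff g j * s (i - j))
        = (\<Sum>j\<le>degree g. \<Sum>\<beta>\<in>Z. \<beta> ^ i * (coeff g j * inverse \<beta> ^ j))"
      unfolding s sum_distrib_left
    proof (intro sum.cong refl)
      fix j \<beta> assume "j \<in> {..degree g}" "\<beta> \<in> Z"
      then have "\<beta> \<noteq> 0" "j \<le> i"
        using nz that by auto
      then have "\<beta> ^ (i - j) = \<beta> ^ i * inverse \<beta> ^ j"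
        by (simp add: power_diff power_inverse divide_inverse)
      then show "coeff g j * \<beta> ^ (i - j) = \<beta> ^ i * (coeff g j * inverse \<beta> ^ j)"
        by simp
    qed
    also have "\<dots> = (\<Sum>\<beta>\<in>Z. \<beta> ^ i * poly g (inverse \<beta>))"
      by (subst sum.swap) (simp add: poly_altdef sum_distrib_left)
    finally show ?thesis .
  qed
  have "poly g (inverse \<beta>) = 0"
    if "\<forall>i\<ge>degree g. (\<Sum>j\<le>degree g. coeff g j * s (i - j)) = 0" and "\<beta> \<in> Z" for \<beta>
  proof -
    have "\<beta> ^ degree g * poly g (inverse \<beta>) = 0"
    proof (rule two_sided_vandermonde[OF fin, where X = id and Z = id and l = "card Z" and r = 0
          and y = "\<lambda>\<beta>. \<beta> ^ degree g * poly g (inverse \<beta>)"])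
      fix i j :: nat assume "j \<le> 0"
      have "(\<Sum>\<beta>\<in>Z. \<beta> ^ (degree g + i) * poly g (inverse \<beta>)) = 0"
        using recurrence[of "degree g + i"] that(1) by simp
      then show "(\<Sum>\<beta>\<in>Z. \<beta> ^ degree g * poly g (inverse \<beta>) * id \<beta> ^ i * id \<beta> ^ j) = 0"
        using \<open>j \<le> 0\<close> by (simp add: power_add mult_ac)
    qed (use that(2) fin ne in \<open>auto simp: card_gt_0_iff\<close>)
    then show ?thesis
      using that(2) nz by auto
  qed
  then show ?thesis
    using recurrence by (auto simp: conn_poly_def)
qed

text \<open>The product of the factors 1 - \<beta> X is a connection polynomial, binary because
  squaring permutes \<open>Z\<close>. Any other one has \<open>card Z\<close> distinct roots, hence
  no smaller degree.\<close>

lemma linear_span_power_sums: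
  fixes Z :: "'a::field set"
  assumes char: "CHAR('a) = 2"
    and fin: "finite Z" and ne: "Z \<noteq> {}" and nz: "0 \<notin> Z"
    and square: "\<And>\<beta>. \<beta> \<in> Z \<Longrightarrow> \<beta>\<^sup>2 \<in> Z"
    and s: "\<And>t. s t = (\<Sum>\<beta>\<in>Z. \<beta> ^ t)"
  shows "linear_span s = card Z"
proof -
  note conn_iff = conn_poly_power_sums_iff[OF fin ne nz s]
  have inj: "inj_on (\<lambda>\<beta>. \<beta>\<^sup>2) Z"
    using power2_inject_char2[OF char] by (auto intro: inj_onI)
  have image: "(\<lambda>\<beta>. \<beta>\<^sup>2) ` Z = Z"
    using endo_inj_surj[OF fin _ inj] square by blast
  define P where "P = (\<Prod>\<beta>\<in>Z. [:1, -\<beta>:])"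
  have "degree P = (\<Sum>\<beta>\<in>Z. degree [:1, -\<beta>:])"
    unfolding P_def by (rule degree_prod_sum_eq) auto
  also have "\<dots> = card Z"
    using nz by (subst sum.cong[OF refl, of _ _ "\<lambda>_. 1"]) auto
  finally have deg: "degree P = card Z" .
  have factor: "[:1, -\<beta>:]\<^sup>2 = pcompose [:1, -(\<beta>\<^sup>2):] (monom 1 2)" for \<beta> :: 'a
    using add_self_char2[OF char, of "-\<beta>"] minus_char2[OF char, of "\<beta>\<^sup>2"]
    by (simp add: power2_eq_square numeral_2_eq_2 monom_Suc pcompose_pCons)
  have "P\<^sup>2 = (\<Prod>\<beta>\<in>Z. pcompose [:1, -(\<beta>\<^sup>2):] (monom 1 2))"
    by (simp only: P_def prod_power_distrib factor)
  also have "\<dots> = (\<Prod>\<beta>\<in>(\<lambda>\<beta>. \<beta>\<^sup>2) ` Z. pcompose [:1, -\<beta>:] (monom 1 2))"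
    by (simp only: prod.reindex[OF inj] o_def)
  also have "\<dots> = pcompose P (monom 1 2)"
    by (simp only: image P_def pcompose_prod)
  finally have "binary_poly P"
    by (simp add: binary_poly_iff_square[OF char])
  moreover have "coeff P 0 = 1"
    by (simp add: P_def poly_prod flip: poly_0_coeff_0)
  moreover have "poly P (inverse \<beta>) = 0" if "\<beta> \<in> Z" for \<beta>
  proof -
    have "\<beta> \<noteq> 0"
      using that nz by auto
    then show ?thesis
      using that fin by (auto simp: P_def poly_prod intro!: bexI[of _ \<beta>])
  qed
  ultimately have "conn_poly s P"
    by (simp add: conn_iff)
  moreover have "card Z \<le> degree g" if "conn_poly s g" for g
  proof -
    have g: "g \<noteq> 0" "\<forall>\<beta>\<in>Z. poly g (inverse \<beta>) = 0"
      using that by (auto simp: conn_iff)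
    have "card (inverse ` Z) \<le> card {x. poly g x = 0}"
      using g by (intro card_mono poly_roots_finite) auto
    then show ?thesis
      using card_poly_roots_bound[OF g(1)] by (simp add: card_image inj_on_def)
  qed
  ultimately show ?thesis
    unfolding linear_span_def using deg by (intro Least_equality) auto
qed

subsection \<open>Coset leaders\<close>

text \<open>\<open>leader k j i\<close> for \<open>i < 2^j\<close> runs through the odd numbers with \<open>j + 3\<close> binary digits whose
  second digit is 1 or 0 according to the condition. These, with 1 and 3 for odd \<open>k\<close>, are the odd
  numbers that, for \<open>k = (m - 3) / 2\<close>, occur an odd number of times once \<open>f\<^sub>4(x + 1)\<close> is
  expanded and all factors 2 are
  dropped from the exponents.\<close>
definition leader :: "nat \<Rightarrow> nat \<Rightarrow> nat \<Rightarrow> nat" where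
  "leader k j i = 2 ^ (j + 2) + (if j + 3 \<le> k \<and> odd (k + j) then 2 ^ (j + 1) else 0) + 2 * i + 1"

definition leaders :: "nat \<Rightarrow> nat set" where
  "leaders k = (if odd k then {1, 3} else {}) \<union> (\<lambda>(j, i). leader k j i) ` (SIGMA j:{..<k}. {..<2 ^ j})"

lemma leader_bounds:
  assumes "i < 2 ^ j"
  shows "2 ^ (j + 2) \<le> leader k j i" and "leader k j i < 2 ^ (j + 3)"
proof -
  have "2 * i + 1 < 2 * 2 ^ j"
    using assms by linarith
  then show "2 ^ (j + 2) \<le> leader k j i" "leader k j i < 2 ^ (j + 3)"
    by (auto simp: leader_def numeral_3_eq_3)
qed

text \<open>The number of binary digits, \<open>j + 3\<close>, recovers \<open>j\<close>; this fixes
  all summands except \<open>2 * i\<close>.\<close>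

lemma inj_on_leader: "inj_on (\<lambda>(j, i). leader k j i) (SIGMA j:{..<k}. {..<2 ^ j})"
proof -
  have le: "j' \<le> j" if "leader k j i = leader k j' i'" "i < 2 ^ j" "i' < 2 ^ j'" for j j' i i'
  proof -
    have "(2::nat) ^ (j' + 2) < 2 ^ (j + 3)"
      using leader_bounds[OF that(2), of k] leader_bounds[OF that(3), of k] that(1) by linarith
    then have "j' + 2 < j + 3"
      by (rule power_less_imp_less_exp[rotated]) simp
    then show ?thesis
      by simp
  qed
  have eq: "j = j' \<and> i = i'" if "leader k j i = leader k j' i'" "i < 2 ^ j" "i' < 2 ^ j'" for j j' i i'
  proof -
    have "j = j'"
      using le[OF that] le[OF that(1)[symmetric] that(3,2)] by simp
    then show ?thesis
      using that(1) by (simp add: leader_def)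
  qed
  show ?thesis
  proof (rule inj_onI, clarify)
    fix j i j' i'
    assume "i < 2 ^ j" "i' < 2 ^ j'" "leader k j i = leader k j' i'"
    from eq[OF this(3,1,2)] show "j = j' \<and> i = i'" .
  qed
qed

lemma leader_disjoint: "{1, 3} \<inter> (\<lambda>(j, i). leader k j i) ` (SIGMA j:{..<k}. {..<2 ^ j}) = {}"
proof -
  have "leader k j i > 3" for j i
  proof -
    have "4 \<le> (2::nat) ^ (j + 2)"
      by simp
    then show ?thesis
      unfolding leader_def by linarith
  qed
  then have "leader k j i \<noteq> 1 \<and> leader k j i \<noteq> 3" for j i
    by (metis less_irrefl not_numeral_less_one)
  then show ?thesis
    by (auto; metis)
qed

lemma card_leaders: "card (leaders k) = 2 ^ k - 1 + (if odd k then 2 else 0)"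
proof -
  let ?L = "(\<lambda>(j, i). leader k j i) ` (SIGMA j:{..<k}. {..<2 ^ j})"
  have "card ?L = (\<Sum>j<k. 2 ^ j)"
    by (simp add: card_image[OF inj_on_leader])
  also have "\<dots> = 2 ^ k - 1"
    by (simp add: lessThan_atLeast0 sum_power2)
  finally have "card ?L = 2 ^ k - 1" .
  moreover have "card ({1, 3} \<union> ?L) = card {1, 3::nat} + card ?L"
    by (rule card_Un_disjoint) (use leader_disjoint in auto)
  ultimately show ?thesis
    by (simp add: leaders_def)
qed

lemma finite_leaders [simp]: "finite (leaders k)"
  by (simp add: leaders_def)

lemma sum_leaders:
  "sum f (leaders k) = (if odd k then f 1 + f 3 else 0) + (\<Sum>j<k. \<Sum>i<2 ^ j. f (leader k j i))"
proof -
  let ?L = "(\<lambda>(j, i). leader k j i) ` (SIGMA j:{..<k}. {..<2 ^ j})"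
  have "sum f ?L = (\<Sum>j<k. \<Sum>i<2 ^ j. f (leader k j i))"
    by (subst sum.reindex[OF inj_on_leader]) (simp add: sum.Sigma case_prod_unfold)
  moreover have "sum f ({1, 3} \<union> ?L) = sum f {1, 3} + sum f ?L"
    by (rule sum.union_disjoint) (use leader_disjoint in auto)
  ultimately show ?thesis
    by (simp add: leaders_def)
qed

lemma leaders_odd_bounded:
  assumes "n \<in> leaders k"
  shows "odd n" and "n < 2 ^ (k + 2)"
proof -
  show "odd n"
    using assms by (auto simp: leaders_def leader_def split: if_splits)
  show "n < 2 ^ (k + 2)"
  proof (cases "n \<in> {1, 3} \<and> odd k")
    case True
    then have "n < 2 ^ 2"
      by auto
    also have "\<dots> \<le> (2::nat) ^ (k + 2)"
      by (rule power_increasing) auto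
    finally show ?thesis .
  next
    case False
    then obtain j i where "j < k" "i < 2 ^ j" "n = leader k j i"
      using assms by (auto simp: leaders_def split: if_splits)
    moreover from this have "n < 2 ^ (j + 3)"
      using leader_bounds by simp
    moreover have "(2::nat) ^ (j + 3) \<le> 2 ^ (k + 2)"
      using \<open>j < k\<close> by (intro power_increasing) auto
    ultimately show ?thesis
      by simp
  qed
qed

text \<open>For \<open>j = k\<close> the condition \<open>j + 3 \<le> Suc k\<close> fails, so the
  longest leaders have second digit 0. They form the progression that feeds the BCH bound.\<close>

lemma top_leaders:
  assumes "i < 2 ^ k"
  shows "2 ^ (k + 2) + 2 * i + 1 \<in> leaders (Suc k)"
  using assms by (force simp: leaders_def leader_def intro!: image_eqI[of _ _ "(k, i)"])

section \<open>Reduction of exponent sums to coset leaders\<close>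

lemma sum_lessThan_double:
  "(\<Sum>i<2 * n. f i) = (\<Sum>i<n. f (2 * i)) + (\<Sum>i<n. f (2 * i + 1 :: nat) :: 'a::comm_monoid_add)"
  by (induction n) (simp_all add: ac_simps)

lemma sum_lessThan_add:
  "(\<Sum>i<n + k. f i) = (\<Sum>i<n. f i) + (\<Sum>i<k. f (n + i :: nat) :: 'a::comm_monoid_add)"
  by (induction k) (simp_all add: ac_simps)

text \<open>Folding even exponents back gives A(k+3) = A(k+1) + e(k) + f(k), so the first sum
  collects e(j) + f(j) for every second j. The second sum adds each e(j) once, leaving f(j) at those
  j and e(j) at the others.\<close>

lemma sum_coset_leaders:
  fixes T :: "nat \<Rightarrow> 'a::comm_ring_1"
  assumes char: "CHAR('a) = 2" and double: "\<And>n. T (2 * n) = T n" and k: "k > 0"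
  shows "(\<Sum>i<2 ^ k. T i) + (\<Sum>i<2 ^ k. T (2 ^ (k + 1) + i)) =
    T 0 + T 1 + (if odd k then T 1 else T 3) + (\<Sum>j<k. \<Sum>i<2 ^ j. T (leader k j i))"
proof -
  note self = add_self_char2[OF char]
  have self': "x + (x + y) = y" for x y :: 'a
    by (simp add: self flip: add.assoc)
  define A where "A k = (\<Sum>i<2 ^ k. T i)" for k :: nat
  define B where "B k = (\<Sum>i<2 ^ k. T (2 ^ (k + 1) + i))" for k :: nat
  \<comment> \<open>\<open>p k\<close> collects all odd exponents below 2^(k+1); \<open>e j\<close>
    and \<open>f j\<close> collect those with \<open>j + 3\<close> digits and second digit 0 and 1
    respectively.\<close>
  define p where "p k = (\<Sum>i<2 ^ k. T (2 * i + 1))" for k :: nat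
  define e where "e j = (\<Sum>i<2 ^ j. T (2 ^ (j + 2) + 2 * i + 1))" for j :: nat
  define f where "f j = (\<Sum>i<2 ^ j. T (2 ^ (j + 2) + 2 ^ (j + 1) + 2 * i + 1))" for j :: nat
  define \<sigma> where "\<sigma> k = (\<Sum>j<k. if j + 3 \<le> k \<and> odd (k + j) then f j else e j)" for k
  have A_Suc: "A (Suc k) = A k + p k" for k
    by (simp add: A_def p_def sum_lessThan_double double)
  have p_Suc: "p (j + 2) = p (j + 1) + (e j + f j)" for j
  proof -
    have "p (j + 2) = (\<Sum>i<2 ^ (j + 1) + (2 ^ j + 2 ^ j). T (2 * i + 1))"
      by (simp add: p_def)
    also have "\<dots> = p (j + 1) + (e j + f j)"
      unfolding sum_lessThan_add by (simp add: p_def e_def f_def algebra_simps)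
    finally show ?thesis .
  qed
  \<comment> \<open>Unfolding A twice adds p(k+1) + p(k+2), in which the two copies of p(k+1)
    cancel.\<close>
  have A_step: "A (k + 3) = A (k + 1) + (e k + f k)" for k
    using A_Suc[of "k + 1"] A_Suc[of "k + 2"] p_Suc[of k]
    by (simp add: numeral_3_eq_3 numeral_2_eq_2 self' add.assoc)
  have "B (Suc k) = B k + e k" for k
  proof -
    have "B (Suc k) = (\<Sum>i<2 ^ k. T (2 * (2 ^ (k + 1) + i))) + e k"
      by (simp add: B_def e_def sum_lessThan_double algebra_simps)
    then show ?thesis
      by (simp only: double B_def)
  qed
  moreover have "B 0 = T 1"
    using double[of 1] by (simp add: B_def numeral_2_eq_2)
  ultimately have B: "B k = T 1 + (\<Sum>j<k. e j)" for k
    by (induction k) (simp_all add: add.assoc)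
  have \<sigma>_step: "\<sigma> (k + 3) = \<sigma> (k + 1) + (e k + f k) + (e (k + 1) + e (k + 2))" for k
  proof -
    \<comment> \<open>Among j < k only j = k - 1 passes the length test for k + 3 but not for k + 1,
      and its parity rules it out anyway.\<close>
    have "(\<Sum>j<k. if j + 3 \<le> k + 3 \<and> odd (k + 3 + j) then f j else e j)
        = (\<Sum>j<k. if j + 3 \<le> k + 1 \<and> odd (k + 1 + j) then f j else e j)"
    proof (intro sum.cong refl)
      fix j assume "j \<in> {..<k}"
      then have "j + 3 \<le> k + 1 \<or> j + 1 = k"
        by auto
      then show "(if j + 3 \<le> k + 3 \<and> odd (k + 3 + j) then f j else e j)
          = (if j + 3 \<le> k + 1 \<and> odd (k + 1 + j) then f j else e j)"
        using \<open>j \<in> {..<k}\<close> by auto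
    qed
    then show ?thesis
      by (simp add: \<sigma>_def numeral_3_eq_3 self' add_ac)
  qed
  \<comment> \<open>The induction goes in steps of two to match \<open>A_step\<close>; the shift by
    1 makes 1 and 2 the base cases.\<close>
  have "A (k + 1) + (\<Sum>j<k + 1. e j) = T 0 + (if odd (k + 1) then T 1 else T 3) + \<sigma> (k + 1)" for k
  proof (induction k rule: induct_nat_012)
    case 0
    show ?case
      by (simp add: A_def \<sigma>_def numeral_2_eq_2)
  next
    case 1
    have "A 2 = T 0 + T 1 + T 2 + T 3"
      by (simp add: A_def eval_nat_numeral)
    then show ?case
      using double[of 1] self' by (simp add: \<sigma>_def numeral_2_eq_2 self add_ac)
  next
    case (ge2 k)
    have "A (k + 3) + (\<Sum>j<k + 3. e j)
        = (A (k + 1) + (\<Sum>j<k + 1. e j)) + (e k + f k) + (e (k + 1) + e (k + 2))"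
      unfolding A_step by (simp add: numeral_3_eq_3 add_ac)
    also have "\<dots> = T 0 + (if odd (k + 1) then T 1 else T 3) + \<sigma> (k + 3)"
      unfolding ge2(1) \<sigma>_step by (simp only: add_ac)
    finally show ?case
      by (simp add: numeral_3_eq_3)
  qed
  from this[of "k - 1"] have "A k + (\<Sum>j<k. e j) = T 0 + (if odd k then T 1 else T 3) + \<sigma> k"
    using k by simp
  moreover have "\<sigma> k = (\<Sum>j<k. \<Sum>i<2 ^ j. T (leader k j i))"
    unfolding \<sigma>_def by (intro sum.cong refl) (simp add: e_def f_def leader_def)
  ultimately show ?thesis
    using B[of k] by (simp add: A_def B_def add_ac)
qed

subsection \<open>The field of order \<open>2^m\<close> and the trace\<close>

text \<open>Translation by 1 permutes the field; comparing the sums of all elements gives 2^m = 0 in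
  it.\<close>

lemma CHAR_eq_2_of_card:
  assumes card: "card (UNIV :: 'a::{field,finite} set) = 2 ^ m"
  shows "CHAR('a) = 2"
proof -
  have "(\<Sum>x\<in>UNIV. x + 1) = (\<Sum>x\<in>UNIV. x :: 'a)"
    by (rule sum.reindex_bij_witness[of _ "\<lambda>x. x - 1" "\<lambda>x. x + 1"]) auto
  then have "of_nat (card (UNIV :: 'a set)) = (0 :: 'a)"
    by (simp add: sum.distrib)
  then have "(2::'a) ^ m = 0"
    by (simp add: card)
  then have "of_nat 2 = (0::'a)"
    by simp
  then have "CHAR('a) dvd 2"
    by (simp only: of_nat_eq_0_iff_char_dvd)
  then have "CHAR('a) = 1 \<or> CHAR('a) = 2"
    using two_is_prime_nat by (auto simp: prime_nat_iff)
  then show ?thesis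
    by simp
qed

lemma trace2_add:
  assumes "CHAR('a::field) = 2"
  shows "trace2 m (x + y :: 'a) = trace2 m x + trace2 m y"
  by (simp add: trace2_def power_two_power_add[OF assms] sum.distrib)

lemma trace2_0 [simp]: "trace2 m 0 = 0"
  by (simp add: trace2_def power_0_left)

lemma trace2_sum:
  assumes "CHAR('a::field) = 2"
  shows "trace2 m (\<Sum>i\<in>I. f i :: 'a) = (\<Sum>i\<in>I. trace2 m (f i))"
  by (induction I rule: infinite_finite_induct) (simp_all add: trace2_add[OF assms])

text \<open>Squaring shifts the conjugates by one place, and the last one wraps around to x.\<close>

lemma trace2_square:
  assumes "x ^ 2 ^ m = x"
  shows "trace2 m (x\<^sup>2) = trace2 m x"
proof -
  have "trace2 m x + x ^ 2 ^ m = x ^ 2 ^ 0 + (\<Sum>i<m. x ^ 2 ^ Suc i)"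
    unfolding trace2_def
    by (rule trans[OF sum.lessThan_Suc[symmetric] sum.lessThan_Suc_shift])
  also have "(\<Sum>i<m. x ^ 2 ^ Suc i) = trace2 m (x\<^sup>2)"
    by (simp add: trace2_def flip: power_mult)
  finally show ?thesis
    using assms by (simp add: add.commute)
qed

lemma power_two_power_inject:
  assumes "CHAR('a::idom) = 2" and "x ^ 2 ^ i = (y::'a) ^ 2 ^ i"
  shows "x = y"
  using assms(2)
proof (induction i)
  case (Suc i)
  then have "(x ^ 2 ^ i)\<^sup>2 = (y ^ 2 ^ i)\<^sup>2"
    by (simp add: mult.commute flip: power_mult)
  then show ?case
    using power2_inject_char2[OF assms(1)] Suc.IH by blast
qed simp

text \<open>From k to k + 1 the new factor (x + 1)^(2^k) = x^(2^k) + 1 appends a copy of the sum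
  shifted by 2^k.\<close>

lemma power_two_power_minus_one:
  assumes "CHAR('a::comm_ring_1) = 2"
  shows "(x + 1 :: 'a) ^ (2 ^ k - 1) = (\<Sum>i<2 ^ k. x ^ i)"
proof (induction k)
  case (Suc k)
  have "(2::nat) ^ Suc k - 1 = (2 ^ k - 1) + 2 ^ k"
    by simp
  then have "(x + 1) ^ (2 ^ Suc k - 1) = (\<Sum>i<2 ^ k. x ^ i) * (x ^ 2 ^ k + 1)"
    by (simp only: power_add Suc.IH power_two_power_add[OF assms]) simp
  also have "\<dots> = (\<Sum>i<2 ^ k + 2 ^ k. x ^ i)"
    unfolding sum_lessThan_add by (simp add: algebra_simps power_add sum_distrib_left sum.distrib)
  finally show ?case
    by (simp add: mult_2)
qed simp

section \<open>The field as 0 and the powers of \<alpha>\<close>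

locale gf2m =
  fixes m k :: nat and \<alpha> :: "'a::{field,finite}"
  assumes card_field: "card (UNIV :: 'a set) = 2 ^ m"
    and prim: "primitive_elem \<alpha>"
    and m_eq: "m = 2 * k + 3"
    and k_pos: "k > 0"
begin

text \<open>The elements whose t-th powers add up to the t-th term of the sequence; 1 accounts for
  the constant in \<open>trace2_f4\<close>. Their inverses are the zeros of the minimal
  polynomial.\<close>

definition spectrum :: "'a set" where
  "spectrum = insert 1 ((\<lambda>(n, i). \<alpha> ^ (n * 2 ^ i)) ` (leaders k \<times> {..<m}))"

lemma char2: "CHAR('a) = 2"
  using CHAR_eq_2_of_card[OF card_field] .

lemma alpha_nonzero: "\<alpha> \<noteq> 0"
  using prim by (simp add: primitive_elem_def)

lemma two_power_m_ge: "(2::nat) ^ m \<ge> 32"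
  using power_increasing[of 5 m "2::nat"] k_pos m_eq by simp

text \<open>Multiplication by \<alpha> permutes the nonzero elements, so their product absorbs this
  power.\<close>

lemma alpha_power_card: "\<alpha> ^ (2 ^ m - 1) = 1"
proof -
  have "(\<Prod>y\<in>UNIV-{0}. \<alpha> * y) = (\<Prod>y\<in>UNIV-{0}. y)"
    by (rule prod.reindex_bij_witness[of _ "\<lambda>y. y / \<alpha>" "\<lambda>y. \<alpha> * y"])
      (use alpha_nonzero in auto)
  then have "\<alpha> ^ card (UNIV - {0::'a}) * \<Prod>(UNIV-{0}) = \<Prod>(UNIV-{0})"
    by (simp add: prod.distrib)
  moreover have "\<Prod>(UNIV-{0::'a}) \<noteq> 0"
    by simp
  ultimately show ?thesis
    by (simp add: card_field)
qed

lemma alpha_power_mod: "\<alpha> ^ (i mod (2 ^ m - 1)) = \<alpha> ^ i"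
proof -
  have "\<alpha> ^ i = \<alpha> ^ ((2 ^ m - 1) * (i div (2 ^ m - 1)) + i mod (2 ^ m - 1))"
    by simp
  then show ?thesis
    by (simp only: power_add power_mult alpha_power_card) simp
qed

text \<open>These powers already cover all 2^m - 1 nonzero elements, so none repeats.\<close>

lemma inj_on_alpha_power: "inj_on (\<lambda>i. \<alpha> ^ i) {..<2 ^ m - 1}"
proof (rule eq_card_imp_inj_on)
  have "UNIV - {0} \<subseteq> (\<lambda>i. \<alpha> ^ i) ` {..<2 ^ m - 1}"
  proof
    fix x :: 'a assume "x \<in> UNIV - {0}"
    then obtain i where "x = \<alpha> ^ i"
      using prim by (auto simp: primitive_elem_def)
    then have "x = \<alpha> ^ (i mod (2 ^ m - 1))"
      by (simp only: alpha_power_mod)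
    moreover have "i mod (2 ^ m - 1) < 2 ^ m - 1"
      using two_power_m_ge by (intro mod_less_divisor) linarith
    ultimately show "x \<in> (\<lambda>i. \<alpha> ^ i) ` {..<2 ^ m - 1}"
      by blast
  qed
  then have "card (UNIV - {0::'a}) \<le> card ((\<lambda>i. \<alpha> ^ i) ` {..<2 ^ m - 1})"
    by (intro card_mono) auto
  then have "2 ^ m - 1 \<le> card ((\<lambda>i. \<alpha> ^ i) ` {..<2 ^ m - 1})"
    by (simp add: card_field)
  then show "card ((\<lambda>i. \<alpha> ^ i) ` {..<2 ^ m - 1}) = card {..<(2::nat) ^ m - 1}"
    using card_image_le[of "{..<(2::nat) ^ m - 1}" "\<lambda>i. \<alpha> ^ i"] by simp
qed simp

lemma alpha_power_eq_iff: "\<alpha> ^ i = \<alpha> ^ j \<longleftrightarrow> [i = j] (mod (2 ^ m - 1))"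
proof -
  have "\<alpha> ^ i = \<alpha> ^ j \<longleftrightarrow> \<alpha> ^ (i mod (2 ^ m - 1)) = \<alpha> ^ (j mod (2 ^ m - 1))"
    by (simp only: alpha_power_mod)
  also have "\<dots> \<longleftrightarrow> i mod (2 ^ m - 1) = j mod (2 ^ m - 1)"
  proof (rule inj_on_eq_iff[OF inj_on_alpha_power])
    have "(2::nat) ^ m - 1 > 0"
      using two_power_m_ge by linarith
    then show "i mod (2 ^ m - 1) \<in> {..<2 ^ m - 1}" "j mod (2 ^ m - 1) \<in> {..<2 ^ m - 1}"
      by simp_all
  qed
  finally show ?thesis
    by (simp add: cong_def)
qed

lemma power_field_order: "x ^ 2 ^ m = (x::'a)"
proof (cases "x = 0")
  case False
  then obtain i where i: "x = \<alpha> ^ i"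
    using prim by (auto simp: primitive_elem_def)
  have "x ^ (2 ^ m - 1) = (\<alpha> ^ (2 ^ m - 1)) ^ i"
    by (simp add: i mult.commute flip: power_mult)
  then have "x ^ (2 ^ m - 1) * x = x"
    by (simp only: alpha_power_card) simp
  moreover have "(2::nat) ^ m = Suc (2 ^ m - 1)"
    by simp
  ultimately show ?thesis
    by (metis power_Suc2)
qed simp

section \<open>Expansion of the sequence into traces of powers\<close>

lemma trace2_power_two_power: "trace2 m (x ^ 2 ^ i) = trace2 m (x::'a)"
proof (induction i)
  case (Suc i)
  have "trace2 m (x ^ 2 ^ Suc i) = trace2 m ((x ^ 2 ^ i)\<^sup>2)"
    by (simp add: mult.commute flip: power_mult)
  then show ?case
    by (simp add: trace2_square[OF power_field_order] Suc.IH)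
qed simp

text \<open>The trace of 1 is m modulo 2, and m is odd.\<close>

lemma trace2_one: "trace2 m (1::'a) = 1"
proof -
  have "trace2 m (1::'a) = of_nat (2 * (k + 1) + 1)"
    by (simp add: trace2_def m_eq)
  also have "\<dots> = of_nat 2 * of_nat (k + 1) + 1"
    by (simp only: of_nat_add of_nat_mult of_nat_1)
  also have "of_nat 2 = (0::'a)"
    by (simp only: of_nat_eq_0_iff_char_dvd char2 dvd_refl)
  finally show ?thesis
    by simp
qed

lemma trace2_f4:
  fixes x :: 'a
  shows "trace2 m ((x + 1) + (x + 1) ^ 3 + (x + 1) ^ (2 ^ m - 2 ^ ((m - 1) div 2 + 2) + 2)) =
    1 + (\<Sum>n\<in>leaders k. trace2 m (x ^ n))"
proof -
  define T where "T n = trace2 m (x ^ n)" for n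
  note self = add_self_char2[OF char2]
  have self': "y + (y + z) = z" for y z :: 'a
    by (simp add: self flip: add.assoc)
  have double: "T (2 * n) = T n" for n
    using trace2_square[OF power_field_order, of "x ^ n"]
    by (simp add: T_def mult.commute flip: power_mult)
  have T0: "T 0 = 1"
    by (simp add: T_def trace2_one)
  have lin: "trace2 m (x + 1) = T 1 + 1"
    by (simp add: trace2_add[OF char2] T_def trace2_one)
  have "(x + 1) ^ 3 = (x + 1)\<^sup>2 * (x + 1)"
    by (simp add: numeral_3_eq_3 numeral_2_eq_2)
  also have "\<dots> = x ^ 3 + x ^ 2 + x ^ 1 + x ^ 0"
    by (simp only: power2_add_char2[OF char2]) (simp add: algebra_simps numeral_3_eq_3 numeral_2_eq_2)
  finally have "trace2 m ((x + 1) ^ 3) = T 3 + T 2 + T 1 + T 0"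
    by (simp only: T_def trace2_add[OF char2])
  then have cube: "trace2 m ((x + 1) ^ 3) = T 3 + 1"
    using double[of 1] by (simp add: T0 self add.assoc self')
  define e where "e = 2 ^ (k + 1) + (2 ^ k - 1 :: nat)"
  \<comment> \<open>As z^(2^m) = z, the part 2 * 2^m of the exponent acts as 2. So the third term of
    the polynomial is a Frobenius power of (x + 1)^e, and the trace does not see the
    difference.\<close>
  have exponent: "e * 2 ^ (k + 3) = 2 ^ m * 2 + (2 ^ m - 2 ^ ((m - 1) div 2 + 2))"
  proof -
    have "m = k + (k + 3)"
      by (simp add: m_eq)
    then have "(2::nat) ^ m = 2 ^ k * 2 ^ (k + 3)"
      by (simp only: power_add[of _ k])
    moreover have "(m - 1) div 2 + 2 = k + 3"
      by (simp add: m_eq)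
    moreover have "e * 2 ^ (k + 3) = 2 * (2 ^ k * 2 ^ (k + 3)) + (2 ^ k * 2 ^ (k + 3) - 2 ^ (k + 3))"
      unfolding e_def add_mult_distrib diff_mult_distrib by simp
    ultimately show ?thesis
      by (simp only: mult.commute[of _ 2])
  qed
  have "((x + 1) ^ e) ^ 2 ^ (k + 3) = (x + 1) ^ (2 ^ m - 2 ^ ((m - 1) div 2 + 2) + 2)"
    by (simp only: exponent power_mult[symmetric])
      (simp only: power_add[of "x + 1"] power_mult power_field_order mult.commute)
  then have "trace2 m ((x + 1) ^ (2 ^ m - 2 ^ ((m - 1) div 2 + 2) + 2)) = trace2 m ((x + 1) ^ e)"
    by (metis trace2_power_two_power)
  also have "(x + 1) ^ e = (x ^ 2 ^ (k + 1) + 1) * (\<Sum>i<2 ^ k. x ^ i)"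
    by (simp only: e_def power_add[of _ "2 ^ (k + 1)"] power_two_power_minus_one[OF char2]
        power_two_power_add[OF char2] power_one)
  also have "\<dots> = (\<Sum>i<2 ^ k. x ^ i) + (\<Sum>i<2 ^ k. x ^ (2 ^ (k + 1) + i))"
    by (simp add: algebra_simps power_add sum_distrib_left sum_distrib_right)
  also have "trace2 m \<dots> = (\<Sum>i<2 ^ k. T i) + (\<Sum>i<2 ^ k. T (2 ^ (k + 1) + i))"
    by (simp only: T_def trace2_add[OF char2] trace2_sum[OF char2])
  also have "\<dots> = T 0 + T 1 + (if odd k then T 1 else T 3) + (\<Sum>j<k. \<Sum>i<2 ^ j. T (leader k j i))"
    by (rule sum_coset_leaders[where T = T]) (use char2 double k_pos in auto)
  finally have high: "trace2 m ((x + 1) ^ (2 ^ m - 2 ^ ((m - 1) div 2 + 2) + 2)) =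
      T 0 + T 1 + (if odd k then T 1 else T 3) + (\<Sum>j<k. \<Sum>i<2 ^ j. T (leader k j i))" .
  have "trace2 m ((x + 1) + (x + 1) ^ 3 + (x + 1) ^ (2 ^ m - 2 ^ ((m - 1) div 2 + 2) + 2))
      = (T 1 + 1) + (T 3 + 1) + (T 0 + T 1 + (if odd k then T 1 else T 3)
        + (\<Sum>j<k. \<Sum>i<2 ^ j. T (leader k j i)))"
    by (simp only: high cube lin trace2_add[OF char2, of m "x + 1" "(x + 1) ^ 3"]
        trace2_add[OF char2, of m "(x + 1) + (x + 1) ^ 3"])
  \<comment> \<open>The three constants add up to 1, and the T 1 of the linear term cancels one from
    the last term. T 3 and the parity term leave T 1 + T 3 for odd k and nothing for even k, as in
    \<open>leaders\<close>.\<close>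
  also have "\<dots> = 1 + sum T (leaders k)"
    unfolding sum_leaders T0 by (simp add: self self' add_ac)
  finally show ?thesis
    by (simp only: T_def[abs_def])
qed

section \<open>Distinctness of the cyclotomic cosets\<close>

lemma alpha_power_two_power_eq:
  assumes "\<alpha> ^ n = \<alpha> ^ (n' * 2 ^ d)" and "d \<le> k + 1" and "n < 2 ^ (k + 2)" and "n' < 2 ^ (k + 2)"
  shows "n = n' * 2 ^ d"
proof -
  \<comment> \<open>The largest such exponent is (2^(k+2) - 1) * 2^(k+1) = 2^m - 2^(k+1), so nothing
    wraps around modulo 2^m - 1.\<close>
  have *: "n'' * 2 ^ d' < 2 ^ m - 1" if "n'' < 2 ^ (k + 2)" "d' \<le> k + 1" for n'' d' :: nat
  proof -
    have "n'' * 2 ^ d' \<le> (2 ^ (k + 2) - 1) * 2 ^ (k + 1)"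
      using that by (intro mult_mono power_increasing) auto
    also have "\<dots> = 2 ^ m - 2 ^ (k + 1)"
    proof -
      have "m = k + 2 + (k + 1)"
        by (simp add: m_eq)
      then show ?thesis
        by (simp only: power_add[of _ "k + 2"] diff_mult_distrib mult_1)
    qed
    also have "\<dots> < 2 ^ m - 1"
      using power_strict_increasing[of 0 "k + 1" "2::nat"]
        power_strict_increasing[of "k + 1" m "2::nat"] m_eq
      by (intro diff_less_mono2) auto
    finally show ?thesis .
  qed
  have "n < 2 ^ m - 1" "n' * 2 ^ d < 2 ^ m - 1"
    using *[of n 0] *[of n' d] assms by auto
  then show ?thesis
    using assms(1) by (simp add: alpha_power_eq_iff cong_def)
qed

lemma coset_injective_le:
  assumes eq: "\<alpha> ^ (n * 2 ^ i) = \<alpha> ^ (n' * 2 ^ j)" and n: "n \<in> leaders k" "n' \<in> leaders k"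
    and ij: "i \<le> j" "j < m"
  shows "n = n' \<and> i = j"
proof -
  define d where "d = j - i"
  have j: "j = d + i"
    using ij by (simp add: d_def)
  have bounds: "n < 2 ^ (k + 2)" "n' < 2 ^ (k + 2)" and odd: "odd n" "odd n'"
    using leaders_odd_bounded n by blast+
  have "(\<alpha> ^ n) ^ 2 ^ i = (\<alpha> ^ (n' * 2 ^ d)) ^ 2 ^ i"
    using eq by (simp add: j power_add mult.assoc flip: power_mult)
  then have eq': "\<alpha> ^ n = \<alpha> ^ (n' * 2 ^ d)"
    by (rule power_two_power_inject[OF char2])
  show ?thesis
  proof (cases "d \<le> k + 1")
    case True
    then have "n = n' * 2 ^ d"
      using alpha_power_two_power_eq eq' bounds by blast
    then show ?thesis
      using odd j by (cases d) auto
  next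
    case False
    \<comment> \<open>For a large shift, m - d further squarings exchange the roles of n and n'. The
      new shift is at most k + 1 and positive, so n' would be even.\<close>
    have "(\<alpha> ^ n) ^ 2 ^ (m - d) = ((\<alpha> ^ n') ^ 2 ^ d) ^ 2 ^ (m - d)"
      using eq' by (simp add: power_mult)
    also have "\<dots> = (\<alpha> ^ n') ^ 2 ^ (d + (m - d))"
      by (simp only: power_add power_mult)
    also have "d + (m - d) = m"
      using ij j by simp
    finally have "\<alpha> ^ n' = \<alpha> ^ (n * 2 ^ (m - d))"
      by (simp add: power_field_order power_mult)
    moreover have "m - d \<le> k + 1"
      using False m_eq by simp
    ultimately have "n' = n * 2 ^ (m - d)"
      using alpha_power_two_power_eq bounds by blast
    moreover have "m - d > 0"
      using ij j by simp
    ultimately show ?thesis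
      using odd by simp
  qed
qed

lemma inj_on_cosets: "inj_on (\<lambda>(n, i). \<alpha> ^ (n * 2 ^ i)) (leaders k \<times> {..<m})"
proof (rule inj_onI, clarify)
  fix n i n' j
  assume *: "n \<in> leaders k" "n' \<in> leaders k" "i < m" "j < m"
    and eq: "\<alpha> ^ (n * 2 ^ i) = \<alpha> ^ (n' * 2 ^ j)"
  show "n = n' \<and> i = j"
  proof (cases "i \<le> j")
    case True
    then show ?thesis
      using coset_injective_le[OF eq *(1,2) _ *(4)] by blast
  next
    case False
    then have "n' = n \<and> j = i"
      using coset_injective_le[OF eq[symmetric] *(2,1) _ *(3)] by linarith
    then show ?thesis
      by simp
  qed
qed

lemma one_notin_cosets: "1 \<notin> (\<lambda>(n, i). \<alpha> ^ (n * 2 ^ i)) ` (leaders k \<times> {..<m})"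
proof clarify
  fix n i assume n: "n \<in> leaders k" and "1 = \<alpha> ^ (n * 2 ^ i)"
  \<comment> \<open>Writing 1 with exponent \<open>0 * 2 ^ 0\<close> makes the comparison of
    exponents applicable to it.\<close>
  then have "(\<alpha> ^ n) ^ 2 ^ i = (\<alpha> ^ (0 * 2 ^ 0)) ^ 2 ^ i"
    by (simp add: power_mult)
  then have "\<alpha> ^ n = \<alpha> ^ (0 * 2 ^ 0)"
    by (rule power_two_power_inject[OF char2])
  then have "n = 0 * 2 ^ 0"
    by (rule alpha_power_two_power_eq) (use leaders_odd_bounded[OF n] in auto)
  then show False
    using leaders_odd_bounded(1)[OF n] by simp
qed

lemma card_spectrum: "card spectrum = 1 + m * card (leaders k)"
  using one_notin_cosets by (simp add: spectrum_def card_image[OF inj_on_cosets] card_cartesian_product)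

text \<open>Each trace unfolds into the t-th powers of one coset, and distinctness of the cosets
  turns the double sum into a sum over a set.\<close>

lemma sum_spectrum_powers:
  assumes "\<forall>t. s t = trace2 m ((\<lambda>x. x + x ^ 3 + x ^ (2 ^ m - 2 ^ ((m - 1) div 2 + 2) + 2)) (\<alpha> ^ t + 1))"
  shows "s t = (\<Sum>\<beta>\<in>spectrum. \<beta> ^ t)"
proof -
  have "(\<Sum>\<beta>\<in>spectrum. \<beta> ^ t) = 1 + (\<Sum>\<beta>\<in>(\<lambda>(n, i). \<alpha> ^ (n * 2 ^ i)) ` (leaders k \<times> {..<m}). \<beta> ^ t)"
    unfolding spectrum_def by (subst sum.insert) (use one_notin_cosets in auto)
  also have "\<dots> = 1 + (\<Sum>n\<in>leaders k. trace2 m ((\<alpha> ^ t) ^ n))"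
    by (subst sum.reindex[OF inj_on_cosets])
      (simp add: trace2_def sum.cartesian_product case_prod_unfold mult_ac flip: power_mult)
  also have "\<dots> = s t"
    unfolding trace2_f4[symmetric] using assms by simp
  finally show ?thesis ..
qed

lemma spectrum_nonzero: "0 \<notin> spectrum"
  using alpha_nonzero by (auto simp: spectrum_def)

lemma alpha_power_in_spectrum:
  assumes "n \<in> leaders k" and "i < m" and "[q = n * 2 ^ i] (mod (2 ^ m - 1))"
  shows "\<alpha> ^ q \<in> spectrum"
proof -
  have "\<alpha> ^ q = \<alpha> ^ (n * 2 ^ i)"
    using assms(3) by (simp only: alpha_power_eq_iff)
  then show ?thesis
    using assms by (auto simp: spectrum_def)
qed

text \<open>Closure under Frobenius is what makes the polynomial with the inverse roots
  binary.\<close>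

lemma spectrum_square: "\<beta> \<in> spectrum \<Longrightarrow> \<beta>\<^sup>2 \<in> spectrum"
proof -
  assume "\<beta> \<in> spectrum"
  then consider "\<beta> = 1" | n i where "n \<in> leaders k" "i < m" "\<beta> = \<alpha> ^ (n * 2 ^ i)"
    by (auto simp: spectrum_def)
  then show ?thesis
  proof cases
    case 1
    then show ?thesis
      by (simp add: spectrum_def)
  next
    case 2
    have \<beta>2: "\<beta>\<^sup>2 = (\<alpha> ^ n) ^ 2 ^ Suc i"
      by (simp add: 2 mult_ac flip: power_mult)
    show ?thesis
    proof (cases "Suc i = m")
      case True
      then have "\<beta>\<^sup>2 = \<alpha> ^ (n * 2 ^ 0)"
        using \<beta>2 power_field_order by simp
      then show ?thesis
        using alpha_power_in_spectrum[of n 0 "n * 2 ^ 0"] 2 m_eq by simp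
    next
      case False
      then have "\<alpha> ^ (n * 2 ^ Suc i) \<in> spectrum"
        using 2 by (intro alpha_power_in_spectrum[of n "Suc i"]) auto
      then show ?thesis
        by (simp only: \<beta>2 power_mult)
    qed
  qed
qed

end

subsection \<open>Weights of codewords\<close>

context gf2m
begin

lemma inj_on_inverse_alpha_power:
  assumes "coprime b (2 ^ m - 1)"
  shows "inj_on (\<lambda>t. inverse (\<alpha> ^ b) ^ t) {..<2 ^ m - 1}"
proof (rule inj_onI)
  fix t u assume tu: "t \<in> {..<2 ^ m - 1}" "u \<in> {..<2 ^ m - 1}"
    and "inverse (\<alpha> ^ b) ^ t = inverse (\<alpha> ^ b) ^ u"
  then have "\<alpha> ^ (b * t) = \<alpha> ^ (b * u)"
    by (simp add: power_inverse power_mult)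
  then have "[t = u] (mod (2 ^ m - 1))"
    using assms by (simp only: alpha_power_eq_iff cong_mult_lcancel_nat)
  then show "t = u"
    using tu by (simp add: cong_def)
qed

text \<open>Codewords vanish at the inverses of the spectrum, so a pattern of exponents becomes the
  pattern of zeros in \<open>hartmann_tzeng_bound\<close>.\<close>

lemma weight_ge:
  assumes roots: "\<And>\<beta>. \<beta> \<in> spectrum \<Longrightarrow> poly c (inverse \<beta>) = 0"
    and c: "c \<noteq> 0" "degree c < 2 ^ m - 1"
    and cop: "coprime b (2 ^ m - 1)" "coprime d (2 ^ m - 1)" and l: "l > 0"
    and spectrum: "\<And>i j. i < l \<Longrightarrow> j \<le> r \<Longrightarrow> \<alpha> ^ (a + b * i + d * j) \<in> spectrum"
  shows "l + r + 1 \<le> weight c"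
proof (rule hartmann_tzeng_bound[OF c _ inj_on_inverse_alpha_power[OF cop(1)]
      inj_on_inverse_alpha_power[OF cop(2)] l, where a = "inverse (\<alpha> ^ a)"])
  show "inverse (\<alpha> ^ a) \<noteq> 0"
    using alpha_nonzero by simp
  fix i j assume "i < l" "j \<le> r"
  then have "poly c (inverse (\<alpha> ^ (a + b * i + d * j))) = 0"
    using roots spectrum by blast
  then show "poly c (inverse (\<alpha> ^ a) * inverse (\<alpha> ^ b) ^ i * inverse (\<alpha> ^ d) ^ j) = 0"
    by (simp add: power_add power_mult power_inverse)
qed

lemma coprime_2: "coprime 2 ((2::nat) ^ m - 1)"
  using m_eq by simp

lemma weight_ge_top:
  assumes roots: "\<And>\<beta>. \<beta> \<in> spectrum \<Longrightarrow> poly c (inverse \<beta>) = 0"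
    and c: "c \<noteq> 0" "degree c < 2 ^ m - 1" "binary_poly c" and k: "k > 1"
  shows "2 ^ (k - 1) + 2 \<le> weight c"
proof -
  \<comment> \<open>As k' = k - 1 is positive, the BCH value 2^k' + 1 is odd, and an even weight
    must exceed it.\<close>
  obtain k' where k': "k = Suc k'" "k' > 0"
    using k by (cases k) auto
  have "\<alpha> ^ (2 ^ (k' + 2) + 1 + 2 * i + 1 * j) \<in> spectrum" if "i < 2 ^ k'" "j \<le> 0" for i j
    using top_leaders[OF that(1)] that(2) m_eq
    by (intro alpha_power_in_spectrum[of "2 ^ (k' + 2) + 2 * i + 1" 0]) (simp_all add: k' ac_simps)
  then have "2 ^ k' + 0 + 1 \<le> weight c"
    by (intro weight_ge[OF roots c(1,2) coprime_2, where a = "2 ^ (k' + 2) + 1" and d = 1]) simp_all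
  moreover have "even (weight c)"
    using even_weight[OF char2 c(3)] roots[of 1] by (simp add: spectrum_def)
  moreover have "odd (2 ^ k' + 0 + 1 :: nat)"
    using k' by simp
  ultimately have "2 ^ k' + 2 \<le> weight c"
    by (metis One_nat_def add_2_eq_Suc' add_Suc_right add_0_right le_neq_implies_less Suc_leI)
  then show ?thesis
    by (simp add: k')
qed

text \<open>For m = 5 all exponents from 0 to 6 occur: 0 for the element 1, then 1, 2, 4 in the
  coset of 1, then 3, 6 in that of 3, and the leader 5. Seven consecutive zeros give 8.\<close>

lemma weight_ge_8_of_k_1:
  assumes roots: "\<And>\<beta>. \<beta> \<in> spectrum \<Longrightarrow> poly c (inverse \<beta>) = 0"
    and c: "c \<noteq> 0" "degree c < 2 ^ m - 1" and k: "k = 1"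
  shows "8 \<le> weight c"
proof -
  have m: "m = 5"
    by (simp add: m_eq k)
  have leaders: "1 \<in> leaders k" "3 \<in> leaders k" "5 \<in> leaders k"
    using top_leaders[of 0 0] by (simp_all add: leaders_def k)
  have "\<alpha> ^ 0 \<in> spectrum"
    by (simp add: spectrum_def)
  moreover have "\<alpha> ^ 1 \<in> spectrum" "\<alpha> ^ 2 \<in> spectrum" "\<alpha> ^ 4 \<in> spectrum"
    using alpha_power_in_spectrum[OF leaders(1), of 0 1] alpha_power_in_spectrum[OF leaders(1), of 1 2]
      alpha_power_in_spectrum[OF leaders(1), of 2 4] by (simp_all add: m)
  moreover have "\<alpha> ^ 3 \<in> spectrum" "\<alpha> ^ 6 \<in> spectrum" "\<alpha> ^ 5 \<in> spectrum"
    using alpha_power_in_spectrum[OF leaders(2), of 0 3] alpha_power_in_spectrum[OF leaders(2), of 1 6]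
      alpha_power_in_spectrum[OF leaders(3), of 0 5] by (simp_all add: m)
  ultimately have *: "\<forall>i\<in>{0, 1, 2, 3, 4, 5, 6}. \<alpha> ^ i \<in> spectrum"
    by simp
  have "\<alpha> ^ (0 + 1 * i + 1 * j) \<in> spectrum" if "i < 7" "j \<le> 0" for i j
  proof -
    have "i \<in> {0, 1, 2, 3, 4, 5, 6}"
      using that(1) by auto
    then have "\<alpha> ^ i \<in> spectrum"
      using * by blast
    then show ?thesis
      using that(2) by simp
  qed
  then have "7 + 0 + 1 \<le> weight c"
    by (intro weight_ge[OF roots c, where a = 0 and b = 1 and d = 1]) simp_all
  then show ?thesis
    by simp
qed

text \<open>For \<open>m = 9\<close> no long enough arithmetic progression of zeros is available, but
  the two-dimensional one \<open>264 + i + 253 j\<close> (\<open>i < 3\<close>, \<open>j < 4\<close>) has all its members in the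
  cosets of 1, 3, 7, 9, 11, 17, 19, 21, so the Hartmann--Tzeng bound is 7.\<close>
lemma weight_ge_8_of_k_3:
  assumes roots: "\<And>\<beta>. \<beta> \<in> spectrum \<Longrightarrow> poly c (inverse \<beta>) = 0"
    and c: "c \<noteq> 0" "degree c < 2 ^ m - 1" "binary_poly c" and k: "k = 3"
  shows "8 \<le> weight c"
proof -
  have m: "m = 9"
    by (simp add: m_eq k)
  have "leader k j i \<in> leaders k" if "j < k" "i < 2 ^ j" for i j
    using that by (force simp: leaders_def)
  from this[of 0 0] this[of 1 0] this[of 1 1] this[of 2 0] this[of 2 1] this[of 2 2]
  have leaders: "1 \<in> leaders k" "3 \<in> leaders k" "7 \<in> leaders k" "9 \<in> leaders k" "11 \<in> leaders k"
    "17 \<in> leaders k" "19 \<in> leaders k" "21 \<in> leaders k"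
    by (simp_all add: k leader_def) (simp_all add: leaders_def)
  have v: "2 ^ m - 1 = (511::nat)" and lt: "0 < m" "1 < m" "3 < m" "8 < m"
    by (simp_all add: m)
  note in_spectrum = alpha_power_in_spectrum[unfolded v cong_def]
  \<comment> \<open>Each exponent is a leader times a power of 2 modulo 511; for instance 17 * 2^8 =
    264 + 8 * 511.\<close>
  have *: "\<forall>q\<in>{264, 265, 266, 517, 518, 519, 770, 771, 772, 1023, 1024, 1025}. \<alpha> ^ q \<in> spectrum"
    using in_spectrum[OF leaders(6) lt(4), of 264] in_spectrum[OF leaders(7) lt(4), of 265]
      in_spectrum[OF leaders(8) lt(4), of 266] in_spectrum[OF leaders(2) lt(2), of 517]
      in_spectrum[OF leaders(3) lt(1), of 518] in_spectrum[OF leaders(1) lt(3), of 519]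
      in_spectrum[OF leaders(3) lt(4), of 770] in_spectrum[OF leaders(4) lt(4), of 771]
      in_spectrum[OF leaders(5) lt(4), of 772] in_spectrum[OF leaders(1) lt(1), of 1023]
      in_spectrum[OF leaders(1) lt(2), of 1024] in_spectrum[OF leaders(2) lt(1), of 1025]
    by simp
  have "\<alpha> ^ (264 + 1 * i + 253 * j) \<in> spectrum" if "i < 3" "j \<le> 3" for i j
  proof -
    have "i \<in> {0, 1, 2}" "j \<in> {0, 1, 2, 3}"
      using that by auto
    then have "264 + 1 * i + 253 * j \<in> {264, 265, 266, 517, 518, 519, 770, 771, 772, 1023, 1024, 1025}"
      by auto
    then show ?thesis
      using * by blast
  qed
  moreover have "coprime 253 ((2::nat) ^ m - 1)"
  proof (rule coprimeI)
    fix d :: nat assume "d dvd 253" "d dvd 2 ^ m - 1"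
    \<comment> \<open>This Bezout combination equals 1.\<close>
    then have "d dvd 253 * 204 - 511 * 101"
      by (intro dvd_diff_nat dvd_mult2) (simp_all add: m)
    then show "is_unit d"
      by simp
  qed
  ultimately have "3 + 3 + 1 \<le> weight c"
    by (intro weight_ge[OF roots c(1,2), where a = 264 and b = 1 and d = 253]) simp_all
  moreover have "even (weight c)"
    using even_weight[OF char2 c(3)] roots[of 1] by (simp add: spectrum_def)
  moreover have "odd (3 + 3 + 1 :: nat)"
    by simp
  ultimately show ?thesis
    by (cases "weight c = 7") auto
qed

section \<open>Parameters of the code\<close>

lemma card_spectrum_less: "card spectrum < 2 ^ m - 1"
proof -
  define u where "u = (2::nat) ^ k"
  have u: "u \<ge> 2"
    using power_increasing[of 1 k "2::nat"] k_pos by (simp add: u_def)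
  have "k < u"
    by (simp add: u_def)
  have "card (leaders k) \<le> u + 1"
    by (auto simp: card_leaders u_def intro: order_trans[OF diff_le_self])
  \<comment> \<open>From k < u follows m = 2k + 3 \<le> 2u + 1, a quadratic bound to be compared
    with 2^m = 8u^2.\<close>
  then have "card spectrum \<le> 1 + (2 * u + 1) * (u + 1)" (is "_ \<le> ?b")
    unfolding card_spectrum using \<open>k < u\<close> m_eq by (intro add_left_mono mult_mono) auto
  moreover have "?b = 2 * (u * u) + 3 * u + 2"
    by (simp add: algebra_simps)
  moreover have "(2::nat) ^ m = 8 * (u * u)"
  proof -
    have "m = 3 + (k + k)"
      by (simp add: m_eq)
    then show ?thesis
      by (simp only: power_add u_def) simp
  qed
  moreover have "2 * u \<le> u * u"
    using u by simp
  ultimately show ?thesis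
    using u by linarith
qed

lemma code_parameters:
  assumes s: "\<forall>t. s t = trace2 m ((\<lambda>x. x + x ^ 3 + x ^ (2 ^ m - 2 ^ ((m - 1) div 2 + 2) + 2)) (\<alpha> ^ t + 1))"
    and g: "minimal_poly_seq s g"
  shows "linear_span s = 1 + m * card (leaders k)"
    and "card (cyclic_code (2 ^ m - 1) g) = 2 ^ (2 ^ m - 1 - linear_span s)"
    and "min_dist (cyclic_code (2 ^ m - 1) g) \<le> linear_span s"
    and "k > 1 \<Longrightarrow> 2 ^ (k - 1) + 2 \<le> min_dist (cyclic_code (2 ^ m - 1) g)"
    and "k = 1 \<or> k = 3 \<Longrightarrow> 8 \<le> min_dist (cyclic_code (2 ^ m - 1) g)"
proof -
  let ?C = "cyclic_code (2 ^ m - 1) g"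
  have fin: "finite spectrum" and ne: "spectrum \<noteq> {}"
    by (auto simp: spectrum_def)
  have span: "linear_span s = card spectrum"
    using linear_span_power_sums[OF char2 fin ne spectrum_nonzero spectrum_square sum_spectrum_powers[OF s]] .
  then show "linear_span s = 1 + m * card (leaders k)"
    by (simp add: card_spectrum)
  have deg: "degree g = card spectrum" and "conn_poly s g"
    using g by (simp_all add: minimal_poly_seq_def span)
  then have bin: "binary_poly g" and "coeff g 0 = 1"
    and roots: "\<forall>\<beta>\<in>spectrum. poly g (inverse \<beta>) = 0"
    using conn_poly_power_sums_iff[OF fin ne spectrum_nonzero sum_spectrum_powers[OF s]] by auto
  then have g0: "g \<noteq> 0"
    by auto
  \<comment> \<open>This makes \<open>g\<close> itself a codeword, so its weight bounds the minimum
    distance from above.\<close>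
  have deg_less: "degree g < 2 ^ m - 1"
    using deg card_spectrum_less by simp
  show "card ?C = 2 ^ (2 ^ m - 1 - linear_span s)"
    using card_cyclic_code[OF char2 bin g0] deg_less by (simp add: deg span)
  \<comment> \<open>With m and the number of leaders odd, the span is even. The trivial bound span +
    1 for the weight of \<open>g\<close> is then odd, and parity lowers it by one.\<close>
  have "odd (card (leaders k))"
    using k_pos by (simp add: card_leaders)
  moreover have "odd m"
    by (simp add: m_eq)
  ultimately have "odd (card spectrum + 1)"
    by (simp add: card_spectrum)
  have "weight g \<le> card {..degree g}"
    by (intro card_mono) (auto intro: le_degree)
  then have "weight g \<le> card spectrum + 1"
    by (simp add: deg)
  moreover have "even (weight g)"
    using even_weight[OF char2 bin] roots by (simp add: spectrum_def)
  moreover note \<open>odd (card spectrum + 1)\<close>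
  ultimately have "weight g \<le> card spectrum"
    by (metis Suc_eq_plus1 le_SucE)
  then show "min_dist ?C \<le> linear_span s"
    using min_dist_cyclic_code(1)[OF char2 bin g0 deg_less] by (simp add: span)
  have code: "binary_poly c" "degree c < 2 ^ m - 1" "\<And>\<beta>. \<beta> \<in> spectrum \<Longrightarrow> poly c (inverse \<beta>) = 0"
    if "c \<in> ?C" "c \<noteq> 0" for c
    using that roots by (auto simp: cyclic_code_def elim!: dvdE)
  show "2 ^ (k - 1) + 2 \<le> min_dist ?C" if "k > 1"
    by (intro min_dist_cyclic_code(2)[OF char2 bin g0 deg_less] weight_ge_top) (use code that in auto)
  show "8 \<le> min_dist ?C" if "k = 1 \<or> k = 3"
  proof (intro min_dist_cyclic_code(2)[OF char2 bin g0 deg_less])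
    fix c assume c: "c \<in> ?C" "c \<noteq> 0"
    show "8 \<le> weight c"
      using that weight_ge_8_of_k_1[OF code(3)[OF c] c(2) code(2)[OF c]]
        weight_ge_8_of_k_3[OF code(3)[OF c] c(2) code(2,1)[OF c]] by blast
  qed
qed

end

section \<open>The two residue classes of m modulo 4\<close>

theorem theorem4:
  fixes m :: nat and \<alpha> :: "'a::{field,finite}" and s :: "nat \<Rightarrow> 'a" and g :: "'a poly"
  assumes "card (UNIV :: 'a set) = 2 ^ m"
    and "m \<ge> 5" and "odd m"
    and "primitive_elem \<alpha>"
    and "\<forall>t. s t = trace2 m ((\<lambda>x. x + x ^ 3 + x ^ (2 ^ m - 2 ^ ((m - 1) div 2 + 2) + 2)) (\<alpha> ^ t + 1))"
    and "minimal_poly_seq s g"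
  shows "(m mod 4 = 1 \<longrightarrow>
            linear_span s = 1 + m * (2 ^ ((m - 3) div 2) + 1) \<and>
            card (cyclic_code (2 ^ m - 1) g) = 2 ^ (2 ^ m - 1 - linear_span s) \<and>
            max 8 (2 ^ ((m - 5) div 2) + 2) \<le> min_dist (cyclic_code (2 ^ m - 1) g) \<and>
            min_dist (cyclic_code (2 ^ m - 1) g) \<le> 1 + m * (2 ^ ((m - 3) div 2) + 1))
       \<and> (m mod 4 = 3 \<longrightarrow>
            linear_span s = 1 + m * (2 ^ ((m - 3) div 2) - 1) \<and>
            card (cyclic_code (2 ^ m - 1) g) = 2 ^ (2 ^ m - 1 - linear_span s) \<and>
            2 ^ ((m - 5) div 2) + 2 \<le> min_dist (cyclic_code (2 ^ m - 1) g) \<and>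
            min_dist (cyclic_code (2 ^ m - 1) g) \<le> 1 + m * (2 ^ ((m - 3) div 2) - 1))"
proof -
  define k where "k = (m - 3) div 2"
  have m: "m = 2 * k + 3"
    using assms(2,3) unfolding k_def by presburger
  interpret gf2m m k \<alpha>
    using assms m by unfold_locales auto
  note params = code_parameters[OF assms(5,6)]
  have k5: "(m - 5) div 2 = k - 1"
    by (simp add: m)
  have odd: "odd k" if "m mod 4 = 1"
    using that m by presburger
  have even: "even k" if "m mod 4 = 3"
    using that m by presburger
  have "linear_span s = 1 + m * (2 ^ k + 1)" if "m mod 4 = 1"
    using params(1) odd[OF that] by (simp add: card_leaders)
  moreover have "linear_span s = 1 + m * (2 ^ k - 1)" if "m mod 4 = 3"
    using params(1) even[OF that] by (simp add: card_leaders)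
  moreover have "2 ^ (k - 1) + 2 \<le> min_dist (cyclic_code (2 ^ m - 1) g)" if "m mod 4 = 3"
  proof -
    have "k > 1"
      using even[OF that] k_pos by (cases "k = 1") auto
    then show ?thesis
      by (rule params(4))
  qed
  \<comment> \<open>Here k is odd. For k = 1 and k = 3 the exponential bound is at most 6, so 8
    decides; from k = 5 on it is at least 18.\<close>
  moreover have "max 8 (2 ^ (k - 1) + 2) \<le> min_dist (cyclic_code (2 ^ m - 1) g)" if "m mod 4 = 1"
  proof (cases "k = 1 \<or> k = 3")
    case True
    then have "(2::nat) ^ (k - 1) + 2 \<le> 8"
      by auto
    then show ?thesis
      using params(5)[OF True] by simp
  next
    case False
    then have "k \<ge> 5"
      using odd[OF that] by presburger
    then have "(2::nat) ^ 4 \<le> 2 ^ (k - 1)"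
      by (intro power_increasing) auto
    then show ?thesis
      using params(4) \<open>k \<ge> 5\<close> by simp
  qed
  ultimately show ?thesis
    using params(2,3) unfolding k5 k_def[symmetric] by auto
qed

end
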